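(* For every integer $n\ge1$, $$\det(M_n;\mathbb N_n,1)=(-1)^{\binom n2}a^n x^{\binom n2}[n]_{t,u}!\prod_{m=1}^{n-1}\prod_{i=1}^{m}\bigl(1-ax^{i}[m-i+1]_{x,y}\bigr),$$ where $\mathbb N_n=\frac{(n+1)(n+2)}2$.
   Context: $[n]_{p,q}=\frac{p^n-q^n}{p-q}$ (so $[0]_{p,q}=0$) and $[n]_{p,q}!=\prod_{m=1}^n[m]_{p,q}$. For $n\ge0$, $M_n$ is the $\mathbb N_n\times\mathbb N_n$ matrix with entries in $\mathbb Z[a,x,y,t,u]$ whose rows and columns are indexed by pairs $(i,j)$ with $1\le j\le i\le n+1$, the pair $(i,j)$ being in position $\frac{i(i-1)}2+j$, with entries $M_n[(i,j),(i,j)]=1-ax^{j-1}[i-j]_{x,y}$; $M_n[(i,j),(i,j+1)]=-ax^{j-1}[i-j]_{x,y}$ for $1\le j\le i-1$; $M_n[(i,j),(i+1,j)]=M_n[(i,j),(i+1,j+1)]=-ax^{j-1}y^{i-j}[i]_{t,u}$ for $i\le n$; all other entries $0$. (Equivalently $M_n=I-aA$, where $A$ is the weighted adjacency matrix of the digraph on $\{(p,q)\in\mathbb N^2:p+q\le n\}$ with edges $(p,q)\to(p,q+1),(p+1,q)$ of weight $x^py^q[p+q+1]_{t,u}$ and $(p,q)\to(p,q)$ ($q>0$), $(p+1,q-1)$ of weight $x^p[q]_{x,y}$.) For a matrix $B$, $(B;r,c)$ denotes $B$ with row $r$ and column $c$ deleted. *)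

theory Defs
  imports "Jordan_Normal_Form.Determinant"
begin

text \<open>
  The ring of polynomials with integer coefficients in the indeterminates a, x, y, t, u,
  as an iterated univariate polynomial ring with a innermost and u outermost.
\<close>

type_synonym zaxytu = "int poly poly poly poly poly"

definition ind_a :: zaxytu where "ind_a = [:[:[:[:[:0, 1:]:]:]:]:]"
definition ind_x :: zaxytu where "ind_x = [:[:[:[:0, 1:]:]:]:]"
definition ind_y :: zaxytu where "ind_y = [:[:[:0, 1:]:]:]"
definition ind_t :: zaxytu where "ind_t = [:[:0, 1:]:]"
definition ind_u :: zaxytu where "ind_u = [:0, 1:]"

text \<open>
  The division is exact for distinct \<open>p\<close>, \<open>q\<close> (see \<open>pq_num_mult\<close>); for \<open>p = q\<close> the value is a
  junk 0, which never occurs for distinct indeterminates.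
\<close>

definition pq_num :: "'a::idom_divide \<Rightarrow> 'a \<Rightarrow> nat \<Rightarrow> 'a" where
  "pq_num p q n = (p ^ n - q ^ n) div (p - q)"

definition pq_fact :: "'a::idom_divide \<Rightarrow> 'a \<Rightarrow> nat \<Rightarrow> 'a" where
  "pq_fact p q n = (\<Prod>m=1..n. pq_num p q m)"

lemma pq_num_mult:
  assumes "p \<noteq> q"
  shows "(p - q) * pq_num p q n = p ^ n - q ^ n"
proof -
  have "p - q dvd p ^ n - q ^ n"
    by (simp add: power_diff_sumr2)
  then show ?thesis
    by (simp add: pq_num_def)
qed

lemma ind_distinct: "ind_x \<noteq> ind_y" "ind_t \<noteq> ind_u"
  by (simp_all add: ind_x_def ind_y_def ind_t_def ind_u_def)

definition NN :: "nat \<Rightarrow> nat" where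
  "NN n = (n + 1) * (n + 2) div 2"

definition pos :: "nat \<times> nat \<Rightarrow> nat" where
  "pos = (\<lambda>(i, j). i * (i - 1) div 2 + j)"

definition pair_at :: "nat \<Rightarrow> nat \<times> nat" where
  "pair_at k = (THE (i, j). 1 \<le> j \<and> j \<le> i \<and> pos (i, j) = k)"

definition M_entry ::
  "'a::idom_divide \<Rightarrow> 'a \<Rightarrow> 'a \<Rightarrow> 'a \<Rightarrow> 'a \<Rightarrow> nat \<Rightarrow> nat \<times> nat \<Rightarrow> nat \<times> nat \<Rightarrow> 'a" where
  "M_entry a x y t u n = (\<lambda>(i, j) (k, l).
     if (k, l) = (i, j) then 1 - a * x ^ (j - 1) * pq_num x y (i - j)
     else if (k, l) = (i, j + 1) \<and> 1 \<le> j \<and> j \<le> i - 1 then - (a * x ^ (j - 1) * pq_num x y (i - j))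
     else if ((k, l) = (i + 1, j) \<or> (k, l) = (i + 1, j + 1)) \<and> i \<le> n
       then - (a * x ^ (j - 1) * y ^ (i - j) * pq_num t u i)
     else 0)"

text \<open>
  Positions are counted from 1, whereas rows and columns of type \<open>'a mat\<close> are counted from 0.
\<close>

definition M_mat :: "'a::idom_divide \<Rightarrow> 'a \<Rightarrow> 'a \<Rightarrow> 'a \<Rightarrow> 'a \<Rightarrow> nat \<Rightarrow> 'a mat" where
  "M_mat a x y t u n =
     mat (NN n) (NN n) (\<lambda>(r, c). M_entry a x y t u n (pair_at (r + 1)) (pair_at (c + 1)))"

lemma tri_Suc: "Suc i * (Suc i - 1) div 2 = i * (i - 1) div 2 + (i::nat)"
proof (cases i)
  case (Suc m)
  have "Suc i * (Suc i - 1) = i * (i - 1) + 2 * i"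
    using Suc by (simp add: algebra_simps)
  then show ?thesis by simp
qed simp

lemma tri_mono: "i \<le> k \<Longrightarrow> i * (i - 1) div 2 \<le> k * (k - 1) div (2::nat)"
  by (intro div_le_mono mult_le_mono) auto

lemma pos_less:
  assumes "i < k" "j \<le> i" "1 \<le> l"
  shows "pos (i, j) < pos (k, l)"
  using tri_mono[of "Suc i" k] tri_Suc[of i] assms by (simp add: pos_def)

lemma pos_inj:
  assumes "1 \<le> j" "j \<le> i" "1 \<le> l" "l \<le> k" "pos (i, j) = pos (k, l)"
  shows "i = k \<and> j = l"
proof -
  have "i = k"
    using assms pos_less[of i k j l] pos_less[of k i l j] by (cases i k rule: linorder_cases) auto
  then show ?thesis using assms by (simp add: pos_def)
qed

lemma pair_at_pos:
  assumes "1 \<le> j" "j \<le> i"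
  shows "pair_at (pos (i, j)) = (i, j)"
  unfolding pair_at_def by (rule the_equality) (use assms pos_inj in auto)

lemma pos_le_NN:
  assumes "j \<le> i" "i \<le> n + 1"
  shows "pos (i, j) \<le> NN n"
  using tri_mono[of "Suc i" "n + 2"] tri_Suc[of i] assms
  by (simp add: pos_def NN_def mult.commute)

lemma M_mat_entry:
  assumes "1 \<le> j" "j \<le> i" "i \<le> n + 1" "1 \<le> l" "l \<le> k" "k \<le> n + 1"
  shows "M_mat a x y t u n $$ (pos (i, j) - 1, pos (k, l) - 1) = M_entry a x y t u n (i, j) (k, l)"
proof -
  have "1 \<le> pos (i, j)" "1 \<le> pos (k, l)"
    using assms by (auto simp: pos_def)
  then show ?thesis
    using assms pos_le_NN[of j i n] pos_le_NN[of l k n]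
    by (simp add: M_mat_def pair_at_pos)
qed

end

theory Submission
  imports Defs
begin

text \<open>
  The matrix \<open>M = I - a A\<close> is upper triangular, so its determinant is known, and the
  minor in question is, up to sign, an entry of its adjugate.  Write \<open>p = j - 1\<close>, \<open>q = i - j\<close>
  and \<open>m = p + q\<close>.  The first row of the inverse of \<open>M\<close>, i.e. the generating function of walks
  from \<open>(0, 0)\<close> to \<open>(p, q)\<close>, has the closed form
  \<open>a^m [m]_{t,u}! x^(p choose 2) y^(q choose 2) binom(m, p)_{x,y} / (\<Prod>k=1..m. 1 - a [k]_{x,y})\<close>,
  which one checks column by column from Pascal's rule,
  \<open>[p + q] = x^p [q] + y^q [p]\<close> and \<open>[p] binom(m, p) = [q + 1] binom(m, p - 1)\<close>.
  Its entry at \<open>(n, 0)\<close>, multiplied by \<open>det M\<close>, is the claimed product.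
\<close>

section \<open>Two-parameter numbers and Gaussian binomials\<close>

lemma pq_num_0 [simp]: "pq_num p q 0 = 0"
  by (simp add: pq_num_def)

lemma pq_num_add:
  assumes "x \<noteq> y"
  shows "pq_num x y (m + n) = x ^ m * pq_num x y n + y ^ n * pq_num x y m"
proof -
  have "(x - y) * pq_num x y (m + n) = x ^ m * ((x - y) * pq_num x y n) + y ^ n * ((x - y) * pq_num x y m)"
    unfolding pq_num_mult[OF assms] by (simp add: algebra_simps power_add)
  also have "\<dots> = (x - y) * (x ^ m * pq_num x y n + y ^ n * pq_num x y m)"
    by (simp add: algebra_simps)
  finally show ?thesis
    using assms by simp
qed

lemma pq_fact_Suc: "pq_fact p q (Suc n) = pq_fact p q n * pq_num p q (Suc n)"
  by (simp add: pq_fact_def)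

text \<open>\<open>pq_binomial x y p q\<close> is the Gaussian binomial coefficient \<open>p + q\<close> over \<open>p\<close>, not \<open>p\<close> over \<open>q\<close>.\<close>

fun pq_binomial :: "'a::comm_ring_1 \<Rightarrow> 'a \<Rightarrow> nat \<Rightarrow> nat \<Rightarrow> 'a" where
  "pq_binomial x y 0 q = 1"
| "pq_binomial x y (Suc p) 0 = 1"
| "pq_binomial x y (Suc p) (Suc q) =
     x ^ Suc p * pq_binomial x y (Suc p) q + y ^ Suc q * pq_binomial x y p (Suc q)"

lemma pq_binomial_0_right [simp]: "pq_binomial x y p 0 = 1"
  by (cases p) auto

text \<open>The two identities are proved together: after Pascal's rule, each needs the equality of
  the two left-hand sides at a smaller \<open>p + q\<close>. This turns both summands into multiples
  of the same binomial, and \<open>pq_num_add\<close> collects the coefficients.\<close>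

lemma pq_binomial_absorb:
  assumes "x \<noteq> y"
  shows "pq_num x y (Suc p) * pq_binomial x y (Suc p) q = pq_num x y (Suc (p + q)) * pq_binomial x y p q
       \<and> pq_num x y (Suc q) * pq_binomial x y p (Suc q) = pq_num x y (Suc (p + q)) * pq_binomial x y p q"
proof (induction "p + q" arbitrary: p q rule: less_induct)
  case less
  have "pq_num x y (Suc p) * pq_binomial x y (Suc p) q = pq_num x y (Suc (p + q)) * pq_binomial x y p q"
  proof (cases q)
    case (Suc r)
    have "pq_num x y (Suc p) * pq_binomial x y (Suc p) q =
        x ^ Suc p * (pq_num x y (Suc p) * pq_binomial x y (Suc p) r)
        + y ^ q * pq_num x y (Suc p) * pq_binomial x y p q"
      by (simp add: Suc algebra_simps)
    also have "pq_num x y (Suc p) * pq_binomial x y (Suc p) r = pq_num x y q * pq_binomial x y p q"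
      using less[of p r] by (simp add: Suc)
    also have "x ^ Suc p * (pq_num x y q * pq_binomial x y p q) + y ^ q * pq_num x y (Suc p) * pq_binomial x y p q
        = pq_num x y (Suc p + q) * pq_binomial x y p q"
      unfolding pq_num_add[OF assms] by (simp add: algebra_simps)
    finally show ?thesis by simp
  qed simp
  moreover have "pq_num x y (Suc q) * pq_binomial x y p (Suc q) = pq_num x y (Suc (p + q)) * pq_binomial x y p q"
  proof (cases p)
    case (Suc r)
    have "pq_num x y (Suc q) * pq_binomial x y p (Suc q) =
        x ^ p * pq_num x y (Suc q) * pq_binomial x y p q
        + y ^ Suc q * (pq_num x y (Suc q) * pq_binomial x y r (Suc q))"
      by (simp add: Suc algebra_simps)
    also have "pq_num x y (Suc q) * pq_binomial x y r (Suc q) = pq_num x y p * pq_binomial x y p q"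
      using less[of r q] by (simp add: Suc)
    also have "x ^ p * pq_num x y (Suc q) * pq_binomial x y p q + y ^ Suc q * (pq_num x y p * pq_binomial x y p q)
        = pq_num x y (p + Suc q) * pq_binomial x y p q"
      unfolding pq_num_add[OF assms] by (simp add: algebra_simps)
    finally show ?thesis by simp
  qed simp
  ultimately show ?case ..
qed

section \<open>Dependence of the closed form on the vertex within a level\<close>

lemma Suc_choose_two: "Suc n choose 2 = n + (n choose 2)"
  by (simp add: numeral_2_eq_2)

definition level_weight :: "'a::comm_ring_1 \<Rightarrow> 'a \<Rightarrow> nat \<Rightarrow> nat \<Rightarrow> 'a" where
  "level_weight x y p q = x ^ (p choose 2) * y ^ (q choose 2) * pq_binomial x y p q"

lemma level_weight_0_0 [simp]: "level_weight x y 0 0 = 1"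
  by (simp add: level_weight_def numeral_2_eq_2)

text \<open>Pascal's rule with the binomial exponents absorbed. The coefficients are the x, y parts
  of the weights of the edges into \<open>(p, q)\<close> from the level below.\<close>

lemma level_weight_pascal:
  assumes "p + q > 0"
  shows "level_weight x y p q =
    (if q = 0 then 0 else x ^ p * y ^ (q - 1) * level_weight x y p (q - 1))
    + (if p = 0 then 0 else x ^ (p - 1) * y ^ q * level_weight x y (p - 1) q)"
  using assms
  by (cases p; cases q) (simp_all add: level_weight_def Suc_choose_two power_add algebra_simps)

text \<open>Expresses the contribution of the edge from \<open>(p, q + 1)\<close> to
  \<open>(p + 1, q)\<close>, of weight x^p [q + 1], as a multiple of the weight of its
  target.\<close>

lemma level_weight_shift:
  assumes "x \<noteq> y"
  shows "y ^ q * pq_num x y (Suc p) * level_weight x y (Suc p) q =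
    x ^ p * pq_num x y (Suc q) * level_weight x y p (Suc q)"
proof -
  have *: "pq_num x y (Suc p) * pq_binomial x y (Suc p) q = pq_num x y (Suc q) * pq_binomial x y p (Suc q)"
    using pq_binomial_absorb[OF assms, of p q] by simp
  have "y ^ q * pq_num x y (Suc p) * level_weight x y (Suc p) q =
      y ^ q * x ^ (p + (p choose 2)) * y ^ (q choose 2) * (pq_num x y (Suc p) * pq_binomial x y (Suc p) q)"
    by (simp add: level_weight_def Suc_choose_two algebra_simps)
  also have "\<dots> = x ^ p * pq_num x y (Suc q) * level_weight x y p (Suc q)"
    unfolding * by (simp add: level_weight_def Suc_choose_two power_add algebra_simps)
  finally show ?thesis .
qed

section \<open>Dependence on the level and the walk recurrence\<close>

text \<open>The product starts at \<open>Suc m\<close> because the denominator of level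
  \<open>m\<close> cancels the first \<open>m\<close> factors of the common denominator.\<close>

definition level_factor :: "'a::idom_divide \<Rightarrow> 'a \<Rightarrow> 'a \<Rightarrow> 'a \<Rightarrow> 'a \<Rightarrow> nat \<Rightarrow> nat \<Rightarrow> 'a" where
  "level_factor a x y t u n m = a ^ m * pq_fact t u m * (\<Prod>k=Suc m..n. 1 - a * pq_num x y k)"

lemma level_factor_step:
  assumes "Suc m \<le> n"
  shows "level_factor a x y t u n m * (a * pq_num t u (Suc m)) =
    level_factor a x y t u n (Suc m) * (1 - a * pq_num x y (Suc m))"
proof -
  have "(\<Prod>k=Suc m..n. 1 - a * pq_num x y k) =
      (1 - a * pq_num x y (Suc m)) * (\<Prod>k=Suc (Suc m)..n. 1 - a * pq_num x y k)"
    using assms by (rule prod.atLeast_Suc_atMost)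
  then show ?thesis
    by (simp add: level_factor_def pq_fact_Suc mult_ac)
qed

text \<open>
  The walk generating function multiplied by the common denominator \<open>\<Prod>k=1..n. 1 - a [k]\<close>,
  to stay in the polynomial ring.
\<close>

definition walk_weight :: "'a::idom_divide \<Rightarrow> 'a \<Rightarrow> 'a \<Rightarrow> 'a \<Rightarrow> 'a \<Rightarrow> nat \<Rightarrow> nat \<times> nat \<Rightarrow> 'a" where
  "walk_weight a x y t u n = (\<lambda>(p, q). level_factor a x y t u n (p + q) * level_weight x y p q)"

text \<open>One column of the linear system for the walk weights: the diagonal entry, the two edges
  from the level below, and the edge within the level. The guards remove predecessors that truncated
  subtraction would invent.\<close>

lemma walk_weight_recurrence:
  assumes "x \<noteq> y" "p + q \<le> n"
  shows "walk_weight a x y t u n (p, q) * (1 - a * x ^ p * pq_num x y q)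
    - (if q = 0 then 0 else
         walk_weight a x y t u n (p, q - 1) * (a * x ^ p * y ^ (q - 1) * pq_num t u (p + q)))
    - (if p = 0 then 0 else
         walk_weight a x y t u n (p - 1, q) * (a * x ^ (p - 1) * y ^ q * pq_num t u (p + q)))
    - (if p = 0 then 0 else
         walk_weight a x y t u n (p - 1, q + 1) * (a * x ^ (p - 1) * pq_num x y (q + 1)))
    = (if p + q = 0 then \<Prod>k=1..n. 1 - a * pq_num x y k else 0)"
proof (cases "p + q")
  case 0
  then show ?thesis
    by (simp add: walk_weight_def level_factor_def pq_fact_def)
next
  case (Suc m)
  let ?F = "level_factor a x y t u n" and ?V = "level_weight x y"
  have step: "?F m * (a * pq_num t u (Suc m)) = ?F (Suc m) * (1 - a * pq_num x y (Suc m))"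
    using Suc assms by (intro level_factor_step) simp
  have out: "(if q = 0 then 0 else
         walk_weight a x y t u n (p, q - 1) * (a * x ^ p * y ^ (q - 1) * pq_num t u (p + q)))
      = ?F m * (a * pq_num t u (Suc m)) * (if q = 0 then 0 else x ^ p * y ^ (q - 1) * ?V p (q - 1))"
    using Suc by (cases q) (auto simp: walk_weight_def)
  have right: "(if p = 0 then 0 else
         walk_weight a x y t u n (p - 1, q) * (a * x ^ (p - 1) * y ^ q * pq_num t u (p + q)))
      = ?F m * (a * pq_num t u (Suc m)) * (if p = 0 then 0 else x ^ (p - 1) * y ^ q * ?V (p - 1) q)"
    using Suc by (cases p) (auto simp: walk_weight_def)
  have level: "(if p = 0 then 0 else
         walk_weight a x y t u n (p - 1, q + 1) * (a * x ^ (p - 1) * pq_num x y (q + 1)))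
      = ?F (Suc m) * a * (y ^ q * pq_num x y p * ?V p q)"
  proof (cases p)
    case (Suc r)
    then show ?thesis
      using \<open>p + q = Suc m\<close> level_weight_shift[OF assms(1), of q r]
      by (simp add: walk_weight_def algebra_simps)
  qed simp
  have num: "pq_num x y (Suc m) = x ^ p * pq_num x y q + y ^ q * pq_num x y p"
    using pq_num_add[OF assms(1), of p q] Suc by simp
  have inflow: "?F m * (a * pq_num t u (Suc m)) * (if q = 0 then 0 else x ^ p * y ^ (q - 1) * ?V p (q - 1))
      + ?F m * (a * pq_num t u (Suc m)) * (if p = 0 then 0 else x ^ (p - 1) * y ^ q * ?V (p - 1) q)
      = ?F (Suc m) * (1 - a * pq_num x y (Suc m)) * ?V p q"
    using level_weight_pascal[of p q x y] Suc by (simp only: step distrib_left[symmetric])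
  have diag: "walk_weight a x y t u n (p, q) = ?F (Suc m) * ?V p q"
    using Suc by (simp add: walk_weight_def)
  \<comment> \<open>Grouping the two lower-level terms by \<open>diff_diff_eq\<close> makes
    \<open>inflow\<close> applicable. What remains is a multiple of [m + 1] - x^p [q] - y^q [p],
    which vanishes by \<open>num\<close>.\<close>
  show ?thesis
    unfolding out right level diff_diff_eq inflow diag using Suc by (simp add: num algebra_simps)
qed

section \<open>Vertices of the digraph and their positions\<close>

definition vertices :: "nat \<Rightarrow> (nat \<times> nat) set" where
  "vertices n = {(p, q). p + q \<le> n}"

definition vertex_pair :: "nat \<times> nat \<Rightarrow> nat \<times> nat" where
  "vertex_pair = (\<lambda>(p, q). (Suc (p + q), Suc p))"

definition vertex_index :: "nat \<times> nat \<Rightarrow> nat" where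
  "vertex_index v = pos (vertex_pair v) - 1"

lemma vertex_index_eq: "vertex_index (p, q) = (p + q) * (p + q + 1) div 2 + p"
  by (simp add: vertex_index_def vertex_pair_def pos_def mult.commute)

lemma Suc_vertex_index: "Suc (vertex_index v) = pos (vertex_pair v)"
  by (cases v) (simp add: vertex_index_def vertex_pair_def pos_def)

lemma pair_at_vertex [simp]: "pair_at (Suc (vertex_index v)) = vertex_pair v"
  unfolding Suc_vertex_index by (cases v) (simp add: vertex_pair_def pair_at_pos)

lemma inj_vertex_pair: "inj vertex_pair"
  by (auto simp: inj_def vertex_pair_def)

lemma inj_vertex_index: "inj vertex_index"
  by (metis inj_def inj_vertex_pair pair_at_vertex)

lemma NN_Suc: "NN (Suc n) = NN n + n + 2"
proof -
  have "(Suc n + 1) * (Suc n + 2) = (n + 1) * (n + 2) + 2 * (n + 2)"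
    by (simp add: algebra_simps)
  then show ?thesis by (simp add: NN_def)
qed

lemma vertices_Suc: "vertices (Suc n) = vertices n \<union> (\<lambda>p. (p, Suc n - p)) ` {..Suc n}"
  by (auto simp: vertices_def image_iff)

lemma vertices_0: "vertices 0 = {(0, 0)}"
  by (auto simp: vertices_def)

lemma finite_vertices [simp]: "finite (vertices n)"
  by (induction n) (simp_all add: vertices_Suc vertices_0)

lemma vertex_index_image: "vertex_index ` vertices n = {..<NN n}"
proof (induction n)
  case 0
  then show ?case by (auto simp: vertices_0 vertex_index_eq NN_def)
next
  case (Suc n)
  \<comment> \<open>The new level occupies the block of positions starting at \<open>NN n\<close>,
    ordered by \<open>p\<close>.\<close>
  have "vertex_index ` (\<lambda>p. (p, Suc n - p)) ` {..Suc n} = (\<lambda>p. NN n + p) ` {..Suc n}"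
    unfolding image_image by (rule image_cong) (simp_all add: vertex_index_eq NN_def)
  also have "\<dots> = {NN n..<NN (Suc n)}"
    by (simp add: NN_Suc atMost_atLeast0 atLeastLessThanSuc_atLeastAtMost)
  finally show ?case
    unfolding vertices_Suc image_Un Suc by (auto simp: NN_Suc)
qed

lemma bij_betw_vertex_index: "bij_betw vertex_index (vertices n) {..<NN n}"
  using inj_vertex_index vertex_index_image by (auto simp: bij_betw_def intro: inj_on_subset)

section \<open>The walk weights as a left solution\<close>

lemma M_mat_carrier [simp]: "M_mat a x y t u n \<in> carrier_mat (NN n) (NN n)"
  by (simp add: M_mat_def)

lemma M_mat_vertex:
  assumes "v \<in> vertices n" "w \<in> vertices n"
  shows "M_mat a x y t u n $$ (vertex_index v, vertex_index w) =
    M_entry a x y t u n (vertex_pair v) (vertex_pair w)"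
proof -
  have "vertex_index v < NN n" "vertex_index w < NN n"
    using assms vertex_index_image[of n] by auto
  then show ?thesis by (simp add: M_mat_def)
qed

text \<open>Writes a column as a combination of four point masses, so that sums against it collapse.
  The inner guards matter: for \<open>q = 0\<close> the vertex \<open>(p, q - 1)\<close> is
  \<open>(p, q)\<close> itself, and likewise \<open>(p - 1, q)\<close> for
  \<open>p = 0\<close>.\<close>

lemma M_entry_vertex:
  assumes "p + q \<le> n"
  shows "M_entry a x y t u n (vertex_pair v) (vertex_pair (p, q)) =
      (if v = (p, q) then 1 - a * x ^ p * pq_num x y q else 0)
    - (if v = (p, q - 1) then
         if q = 0 then 0 else a * x ^ p * y ^ (q - 1) * pq_num t u (p + q) else 0)
    - (if v = (p - 1, q) then
         if p = 0 then 0 else a * x ^ (p - 1) * y ^ q * pq_num t u (p + q) else 0)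
    - (if v = (p - 1, q + 1) then
         if p = 0 then 0 else a * x ^ (p - 1) * pq_num x y (q + 1) else 0)"
proof -
  obtain r s where v: "v = (r, s)"
    by (cases v)
  consider "r = p" "s = q" | "r = p" "q = Suc s" | "p = Suc r" "s = q" | "p = Suc r" "s = Suc q"
    | "\<not> (r = p \<and> s = q)" "\<not> (r = p \<and> q = Suc s)" "\<not> (p = Suc r \<and> s = q)"
      "\<not> (p = Suc r \<and> s = Suc q)"
    by blast
  then show ?thesis
  proof cases
    case 1
    then show ?thesis
      by (auto simp: M_entry_def vertex_pair_def v)
  next
    case 5
    have "M_entry a x y t u n (vertex_pair v) (vertex_pair (p, q)) = 0"
      unfolding M_entry_def vertex_pair_def v prod.case using 5 by (intro if_not_P if_not_P[THEN trans]) auto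
    moreover have "v \<noteq> (p, q)" "q = 0 \<or> v \<noteq> (p, q - 1)" "p = 0 \<or> v \<noteq> (p - 1, q)"
      "p = 0 \<or> v \<noteq> (p - 1, q + 1)"
      using 5 v by auto
    ultimately show ?thesis
      by auto
  qed (use assms in \<open>simp_all add: M_entry_def vertex_pair_def v\<close>)
qed

lemma walk_weight_M_mat:
  assumes "x \<noteq> y" "w \<in> vertices n"
  shows "(\<Sum>v\<in>vertices n. walk_weight a x y t u n v * M_mat a x y t u n $$ (vertex_index v, vertex_index w))
    = (if w = (0, 0) then \<Prod>k=1..n. 1 - a * pq_num x y k else 0)"
proof -
  obtain p q where w: "w = (p, q)" and pq: "p + q \<le> n"
    using assms(2) by (auto simp: vertices_def)
  let ?W = "walk_weight a x y t u n"
  \<comment> \<open>The alternative \<open>c = 0\<close> covers \<open>(p - 1, q + 1)\<close> with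
    \<open>p = 0\<close>, which may lie outside \<open>vertices n\<close>.\<close>
  have delta: "(\<Sum>v\<in>vertices n. ?W v * (if v = v' then c else 0)) = ?W v' * c"
    if "v' \<in> vertices n \<or> c = 0" for v' c
    using that by (auto simp: if_distrib[where f = "\<lambda>z. _ * z"] cong: if_cong)
  have "(\<Sum>v\<in>vertices n. ?W v * M_mat a x y t u n $$ (vertex_index v, vertex_index w)) =
      (\<Sum>v\<in>vertices n. ?W v * (if v = (p, q) then 1 - a * x ^ p * pq_num x y q else 0))
    - (\<Sum>v\<in>vertices n. ?W v * (if v = (p, q - 1) then
         if q = 0 then 0 else a * x ^ p * y ^ (q - 1) * pq_num t u (p + q) else 0))
    - (\<Sum>v\<in>vertices n. ?W v * (if v = (p - 1, q) then
         if p = 0 then 0 else a * x ^ (p - 1) * y ^ q * pq_num t u (p + q) else 0))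
    - (\<Sum>v\<in>vertices n. ?W v * (if v = (p - 1, q + 1) then
         if p = 0 then 0 else a * x ^ (p - 1) * pq_num x y (q + 1) else 0))"
    unfolding sum_subtractf[symmetric] right_diff_distrib[symmetric]
    using assms(2) w pq by (intro sum.cong refl) (simp only: M_mat_vertex M_entry_vertex)
  also have "\<dots> = (if p + q = 0 then \<Prod>k=1..n. 1 - a * pq_num x y k else 0)"
    using pq unfolding walk_weight_recurrence[OF assms(1) pq, symmetric, of a t u]
    by (subst (1 2 3 4) delta) (auto simp: vertices_def)
  finally show ?thesis
    by (simp add: w)
qed

section \<open>Cofactors and the determinant of the matrix\<close>

text \<open>Multiply f A = d e_l on the right by the adjugate: the left side becomes
  \<open>det A\<close> times f, the right side d times row \<open>l\<close> of the adjugate, whose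
  entry \<open>k\<close> is \<open>cofactor A k l\<close>. No division is involved.\<close>

lemma cofactor_of_left_solution:
  fixes A :: "'a::comm_ring_1 mat"
  assumes A: "A \<in> carrier_mat N N" and "k < N" "l < N"
    and sol: "\<And>c. c < N \<Longrightarrow> (\<Sum>r<N. f r * A $$ (r, c)) = (if c = l then d else 0)"
  shows "f k * det A = d * cofactor A k l"
proof -
  have "f k * det A = (\<Sum>r<N. f r * (A * adj_mat A) $$ (r, k))"
    using assms adj_mat[OF A]
    by (simp add: if_distrib[where f = "\<lambda>z. _ * z"] cong: if_cong)
  also have "\<dots> = (\<Sum>r<N. \<Sum>c<N. f r * A $$ (r, c) * cofactor A k c)"
    using A \<open>k < N\<close>
    by (intro sum.cong refl)
      (simp add: adj_mat_def scalar_prod_def sum_distrib_left mult.assoc atLeast0LessThan)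
  also have "\<dots> = (\<Sum>c<N. (\<Sum>r<N. f r * A $$ (r, c)) * cofactor A k c)"
    by (subst sum.swap) (simp add: sum_distrib_right)
  also have "\<dots> = d * cofactor A k l"
    using \<open>l < N\<close> by (simp add: sol if_distrib[where f = "\<lambda>z. z * _"] cong: if_cong)
  finally show ?thesis .
qed

lemma vertex_index_less:
  assumes "p + q < p' + q'"
  shows "vertex_index (p, q) < vertex_index (p', q')"
  using pos_less[of "Suc (p + q)" "Suc (p' + q')" "Suc p" "Suc p'"] assms
    Suc_vertex_index[of "(p, q)"] Suc_vertex_index[of "(p', q')"]
  by (simp add: vertex_pair_def)

text \<open>Positions are ordered by level, then by \<open>p\<close>; no edge lowers the level, and
  none within a level lowers \<open>p\<close>.\<close>

lemma upper_triangular_M_mat: "upper_triangular (M_mat a x y t u n)"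
proof (rule upper_triangularI)
  fix r c assume "c < r" "r < dim_row (M_mat a x y t u n)"
  then have "c < r" "r \<in> vertex_index ` vertices n" "c \<in> vertex_index ` vertices n"
    by (simp_all add: vertex_index_image M_mat_def)
  then obtain p q p' q' where v: "(p, q) \<in> vertices n" "r = vertex_index (p, q)"
    and w: "(p', q') \<in> vertices n" "c = vertex_index (p', q')"
    and less: "vertex_index (p', q') < vertex_index (p, q)"
    by auto
  have "\<not> p + q < p' + q'"
    using vertex_index_less less by force
  moreover have "p' < p" if "p + q = p' + q'"
    using less that by (simp add: vertex_index_eq)
  ultimately show "M_mat a x y t u n $$ (r, c) = 0"
    using v w by (auto simp: M_mat_vertex M_entry_def vertex_pair_def)
qed

lemma prod_vertices:
  "(\<Prod>v\<in>vertices n. f v) = (\<Prod>m\<le>n. \<Prod>p\<le>m. f (p, m - p))"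
proof (induction n)
  case 0
  then show ?case by (simp add: vertices_0)
next
  case (Suc n)
  have "(\<Prod>v\<in>vertices (Suc n). f v) =
      (\<Prod>v\<in>vertices n. f v) * (\<Prod>v\<in>(\<lambda>p. (p, Suc n - p)) ` {..Suc n}. f v)"
    unfolding vertices_Suc by (rule prod.union_disjoint) (simp, simp, auto simp: vertices_def)
  also have "(\<Prod>v\<in>(\<lambda>p. (p, Suc n - p)) ` {..Suc n}. f v) = (\<Prod>p\<le>Suc n. f (p, Suc n - p))"
    by (subst prod.reindex) (auto simp: inj_on_def)
  finally show ?case
    by (simp add: Suc)
qed

text \<open>The factors with \<open>p = 0\<close> form the first product and those with
  \<open>p = m\<close> are 1 since [0] = 0. Level \<open>m + 1\<close> thus leaves a row of
  \<open>m\<close> factors, which shifts the outer index by one.\<close>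

lemma diagonal_product:
  "(\<Prod>m\<le>n. \<Prod>p\<le>m. 1 - a * x ^ p * pq_num x y (m - p)) =
    (\<Prod>k=1..n. 1 - a * pq_num x y k) *
    (\<Prod>m=1..n - 1. \<Prod>i=1..m. 1 - a * x ^ i * pq_num x y (m - i + 1))"
proof (induction n)
  case (Suc n)
  have "(\<Prod>p\<le>Suc n. 1 - a * x ^ p * pq_num x y (Suc n - p)) =
      (\<Prod>p\<le>n. 1 - a * x ^ p * pq_num x y (Suc n - p))"
    by simp
  also have "\<dots> = (1 - a * pq_num x y (Suc n)) * (\<Prod>p=1..n. 1 - a * x ^ p * pq_num x y (Suc n - p))"
    by (simp add: atMost_atLeast0 prod.atLeast_Suc_atMost)
  also have "(\<Prod>p=1..n. 1 - a * x ^ p * pq_num x y (Suc n - p)) =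
      (\<Prod>i=1..n. 1 - a * x ^ i * pq_num x y (n - i + 1))"
    by (intro prod.cong) (auto simp: Suc_diff_le)
  finally have row: "(\<Prod>p\<le>Suc n. 1 - a * x ^ p * pq_num x y (Suc n - p)) =
      (1 - a * pq_num x y (Suc n)) * (\<Prod>i=1..n. 1 - a * x ^ i * pq_num x y (n - i + 1))" .
  have rows: "(\<Prod>m=1..Suc n - 1. \<Prod>i=1..m. g m i) =
      (\<Prod>m=1..n - 1. \<Prod>i=1..m. g m i) * (\<Prod>i=1..n. g n i)" for g :: "nat \<Rightarrow> nat \<Rightarrow> 'a"
    by (cases n) simp_all
  show ?case
    by (subst prod.atMost_Suc) (simp only: Suc row rows, simp add: mult_ac)
qed simp

lemma det_M_mat:
  "det (M_mat a x y t u n) =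
    (\<Prod>k=1..n. 1 - a * pq_num x y k) *
    (\<Prod>m=1..n - 1. \<Prod>i=1..m. 1 - a * x ^ i * pq_num x y (m - i + 1))"
proof -
  let ?M = "M_mat a x y t u n"
  have "det ?M = prod_list (diag_mat ?M)"
    using upper_triangular_M_mat M_mat_carrier by (rule det_upper_triangular)
  also have "\<dots> = (\<Prod>r<NN n. ?M $$ (r, r))"
    by (simp add: prod_list_diag_prod M_mat_def atLeast0LessThan)
  also have "\<dots> = (\<Prod>v\<in>vertices n. ?M $$ (vertex_index v, vertex_index v))"
    by (rule prod.reindex_bij_betw[OF bij_betw_vertex_index, symmetric])
  also have "\<dots> = (\<Prod>v\<in>vertices n. case v of (p, q) \<Rightarrow> 1 - a * x ^ p * pq_num x y q)"
    by (intro prod.cong refl) (auto simp: M_mat_vertex M_entry_def vertex_pair_def)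
  finally show ?thesis
    by (simp add: prod_vertices diagonal_product)
qed

section \<open>The corner cofactor and the minor\<close>

lemma cofactor_M_mat:
  assumes "x \<noteq> y"
  shows "a ^ n * x ^ (n choose 2) * pq_fact t u n * det (M_mat a x y t u n) =
    (\<Prod>k=1..n. 1 - a * pq_num x y k) * cofactor (M_mat a x y t u n) (NN n - 1) 0"
proof -
  let ?M = "M_mat a x y t u n" and ?W = "walk_weight a x y t u n"
  define f where "f = ?W \<circ> the_inv vertex_index"
  have f: "f (vertex_index v) = ?W v" for v
    by (simp add: f_def the_inv_f_f inj_vertex_index)
  \<comment> \<open>The deleted row belongs to \<open>(n, 0)\<close>, the last vertex of the top
    level. There the remaining denominator product is empty and the binomial is 1.\<close>
  have last: "vertex_index (n, 0) = NN n - 1" and "NN n > 0"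
    by (cases n; simp add: vertex_index_eq NN_def NN_Suc; fail)+
  have "f (NN n - 1) * det ?M = (\<Prod>k=1..n. 1 - a * pq_num x y k) * cofactor ?M (NN n - 1) 0"
  proof (rule cofactor_of_left_solution)
    fix c assume "c < NN n"
    then obtain w where w: "w \<in> vertices n" "c = vertex_index w"
      using vertex_index_image[of n] by (metis imageE lessThan_iff)
    have "(\<Sum>r<NN n. f r * ?M $$ (r, c)) =
        (\<Sum>v\<in>vertices n. ?W v * ?M $$ (vertex_index v, vertex_index w))"
      by (subst sum.reindex_bij_betw[OF bij_betw_vertex_index, symmetric]) (simp add: f w)
    moreover have "c = 0 \<longleftrightarrow> w = (0, 0)"
      unfolding w using inj_eq[OF inj_vertex_index, of w "(0, 0)"] by (simp add: vertex_index_eq)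
    ultimately show "(\<Sum>r<NN n. f r * ?M $$ (r, c)) =
        (if c = 0 then \<Prod>k=1..n. 1 - a * pq_num x y k else 0)"
      using walk_weight_M_mat[OF assms w(1)] by simp
  qed (use \<open>NN n > 0\<close> in simp_all)
  moreover have "f (NN n - 1) = a ^ n * x ^ (n choose 2) * pq_fact t u n"
    unfolding last[symmetric] f
    by (simp add: walk_weight_def level_factor_def level_weight_def numeral_2_eq_2)
  ultimately show ?thesis by simp
qed

lemma det_mat_delete_M_mat:
  assumes "x \<noteq> y" and nz: "\<And>k. 1 - a * pq_num x y k \<noteq> 0"
  shows "det (mat_delete (M_mat a x y t u n) (NN n - 1) 0) =
    (- 1) ^ (n choose 2) * a ^ n * x ^ (n choose 2) * pq_fact t u n *
    (\<Prod>m=1..n - 1. \<Prod>i=1..m. 1 - a * x ^ i * pq_num x y (m - i + 1))"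
proof -
  \<comment> \<open>Only the parity of \<open>NN n - 1\<close> matters; the even summand
    \<open>2 * n\<close> drops out of the sign.\<close>
  have NN: "NN n - 1 = 2 * n + (n choose 2)"
    by (induction n) (simp_all add: NN_Suc Suc_choose_two, simp_all add: NN_def)
  have sign: "(- 1) ^ (NN n - 1) = ((- 1) ^ (n choose 2) :: 'a)"
    unfolding NN by (simp add: power_add)
  let ?D = "\<Prod>k=1..n. 1 - a * pq_num x y k" and ?C = "cofactor (M_mat a x y t u n) (NN n - 1) 0"
    and ?P = "\<Prod>m=1..n - 1. \<Prod>i=1..m. 1 - a * x ^ i * pq_num x y (m - i + 1)"
  have "?D \<noteq> 0"
    using nz unfolding prod_zero_iff[OF finite_atLeastAtMost] by blast
  moreover have "?D * (a ^ n * x ^ (n choose 2) * pq_fact t u n * ?P) = ?D * ?C"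
    using cofactor_M_mat[OF assms(1), of a n t u]
    unfolding det_M_mat by (simp only: mult.left_commute[of ?D] mult.assoc)
  ultimately have cof: "?C = a ^ n * x ^ (n choose 2) * pq_fact t u n * ?P"
    by (rule mult_left_cancel[THEN iffD1, symmetric])
  \<comment> \<open>The sign in the cofactor squares to 1, so it can be moved to the other
    side.\<close>
  have "det (mat_delete (M_mat a x y t u n) (NN n - 1) 0) = (- 1) ^ (n choose 2) * ?C"
    unfolding cofactor_def add_0_right sign by (simp flip: mult.assoc power_add mult_2)
  then show ?thesis
    unfolding cof by (simp only: mult.assoc)
qed

text \<open>Licenses cancelling the common denominator: otherwise the indeterminate
  \<open>ind_a\<close> would be a unit.\<close>

lemma one_minus_ind_a_mult_nonzero: "1 - ind_a * z \<noteq> 0"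
proof
  assume "1 - ind_a * z = 0"
  then have "ind_a dvd 1"
    by (metis dvd_triv_left eq_iff_diff_eq_0)
  then show False
    by (simp add: ind_a_def is_unit_const_poly_iff is_unit_poly_iff)
qed

theorem theorem3p7:
  fixes n :: nat
  assumes "n \<ge> 1"
  shows "det (mat_delete (M_mat ind_a ind_x ind_y ind_t ind_u n) (NN n - 1) (1 - 1)) =
    (- 1) ^ (n choose 2) * ind_a ^ n * ind_x ^ (n choose 2) * pq_fact ind_t ind_u n *
    (\<Prod>m=1..n - 1. \<Prod>i=1..m. (1 - ind_a * ind_x ^ i * pq_num ind_x ind_y (m - i + 1)))"
  using det_mat_delete_M_mat[OF ind_distinct(1) one_minus_ind_a_mult_nonzero] by simp

end
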